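(* $\mathcal{B}_{n,r}$ is the disjoint union $\mathcal{B}_{n,r}=\mathcal{B}^0_{n,r}\sqcup\mathcal{B}^1_{n,r}$, where $$\mathcal{B}^0_{n,r}:=\{vb^\top:\ v\in E^n,\ b\in\mathrm{S}^{r-1}\},\qquad \mathcal{B}^1_{n,r}:=\{R\in\mathcal{B}_{n,r}:\ \mathrm{rank}(R)\ge2\}.$$ Moreover, $\mathcal{B}^0_{n,r}$ contains the singular points of $\mathcal{B}_{n,r}$ and $\mathcal{B}^1_{n,r}$ contains the smooth points of $\mathcal{B}_{n,r}$. (When $n$ is odd, $\mathcal{B}^0_{n,r}=\emptyset$.)
   Context: $\mathcal{B}_{n,r}:=\{R\in\mathbb{R}^{n\times r}:\ \mathrm{diag}(RR^\top)=e,\ R^\top e=0\}$, where $e\in\mathbb{R}^n$ is the all-ones vector and $\mathrm{diag}(X)$ is the diagonal vector of the square matrix $X$. $E^n:=\{v\in\{-1,1\}^n:\ e^\top v=0\}$ and $\mathrm{S}^{r-1}$ is the unit sphere of $\mathbb{R}^r$. A point $R\in\mathcal{B}_{n,r}$ is called smooth (nonsingular) if the linear independence constraint qualification (LICQ) holds at $R$, i.e. the linear map $H\mapsto(H^\top e,\mathrm{diag}(HR^\top))$ from $\mathbb{R}^{n\times r}$ to $\mathbb{R}^r\times\mathbb{R}^n$ is surjective; otherwise $R$ is called singular. *)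

theory Defs
  imports "HOL-Analysis.Analysis"
begin

text \<open>
  An \<open>n \<times> r\<close> matrix has type \<open>real ^ 'r ^ 'n\<close>. The two dimensions are the cardinalities of the
  index types, so they range over all positive integers, independently of each other.
\<close>

definition ones :: "real ^ 'n" where
  "ones = (\<chi> i. 1)"

definition diag_vec :: "real ^ 'n ^ 'n \<Rightarrow> real ^ 'n" where
  "diag_vec X = (\<chi> i. X $ i $ i)"

definition outer :: "real ^ 'n \<Rightarrow> real ^ 'r \<Rightarrow> real ^ 'r ^ 'n" where
  "outer v b = (\<chi> i j. v $ i * b $ j)"

definition balanced_signs :: "(real ^ 'n) set" where
  "balanced_signs = {v. (\<forall>i. v $ i \<in> {-1, 1}) \<and> ones \<bullet> v = 0}"

definition Bset :: "(real ^ 'r ^ 'n) set" where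
  "Bset = {R. diag_vec (R ** transpose R) = ones \<and> transpose R *v ones = 0}"

definition Bset0 :: "(real ^ 'r ^ 'n) set" where
  "Bset0 = {outer v b |v b. v \<in> balanced_signs \<and> b \<in> sphere 0 1}"

definition Bset1 :: "(real ^ 'r ^ 'n) set" where
  "Bset1 = {R \<in> Bset. rank R \<ge> 2}"

text \<open>
  The linear independence constraint qualification. The map below is half the derivative
  of the diagonal constraint, paired with the linear constraint.
\<close>

definition LICQ :: "real ^ 'r ^ 'n \<Rightarrow> bool" where
  "LICQ R \<longleftrightarrow>
     surj (\<lambda>H :: real ^ 'r ^ 'n. (transpose H *v ones, diag_vec (H ** transpose R)))"

definition smooth_points :: "(real ^ 'r ^ 'n) set" where
  "smooth_points = {R \<in> Bset. LICQ R}"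

definition singular_points :: "(real ^ 'r ^ 'n) set" where
  "singular_points = {R \<in> Bset. \<not> LICQ R}"

end

theory Submission
  imports Defs
begin

text \<open>
  Write \<open>r\<^sub>i\<close> for the rows of \<open>R\<close>. Membership in \<^const>\<open>Bset\<close> says that the \<open>r\<^sub>i\<close> are unit vectors
  with sum zero. Everything reduces to one dichotomy: either all rows lie on a common line
  through the origin, or they do not.

  If they do, then they agree up to sign, being unit vectors, so \<open>R\<close> is a sign vector times a unit
  vector, and the zero row sum forces the signs to balance; these are exactly the points of \<^const>\<open>Bset0\<close>
  (\<open>Bset0_iff_rows_on_line\<close>). The rank is the dimension of the row space, so this is also the case
  of rank at most one (\<open>rank_less_2_iff_rows_on_line\<close>).

  On the other side, the map in \<^const>\<open>LICQ\<close> is surjective iff its adjoint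
  \<open>(y, l) \<mapsto> (y + l\<^sub>i r\<^sub>i)\<^sub>i\<close> is injective (\<open>LICQ_iff_multipliers_trivial\<close>). A nonzero kernel element
  must have \<open>y \<noteq> 0\<close>, because the rows are not zero, and then every \<open>r\<^sub>i\<close> is a multiple of \<open>y\<close>.
  Conversely, for \<open>R = v b\<^sup>T\<close> with \<open>v\<close> a sign vector, \<open>(b, -v)\<close> is in the kernel because
  \<open>v\<^sub>i\<^sup>2 = 1\<close>. So failure of LICQ is again the condition that the rows lie on a line
  (\<open>not_LICQ_iff_Bset0\<close>).
\<close>

section \<open>The constraint qualification in terms of multipliers\<close>

lemma transpose_ones: "transpose R *v ones = (\<Sum>i\<in>UNIV. (R :: real ^ 'r ^ 'n) $ i)"
  by (simp add: vec_eq_iff matrix_vector_mult_def transpose_def ones_def)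

lemma diag_vec_times_transpose:
  "diag_vec (H ** transpose R) = (\<chi> i. (H :: real ^ 'r ^ 'n) $ i \<bullet> R $ i)"
  by (simp add: vec_eq_iff diag_vec_def matrix_matrix_mult_def transpose_def inner_vec_def)

lemma Bset_iff:
  "R \<in> Bset \<longleftrightarrow> (\<forall>i. norm ((R :: real ^ 'r ^ 'n) $ i) = 1) \<and> (\<Sum>i\<in>UNIV. R $ i) = 0"
  unfolding Bset_def mem_Collect_eq transpose_ones diag_vec_times_transpose
  by (simp add: ones_def norm_eq_1 vec_lambda_inject fun_eq_iff)

text \<open>
  Both constraints act row by row on \<open>H\<close>, so collecting the coefficient of each row gives the
  adjoint of the map in \<^const>\<open>LICQ\<close>.
\<close>
lemma LICQ_map_adjoint:
  fixes H R :: "real ^ 'r ^ 'n"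
  shows "(y, l) \<bullet> (transpose H *v ones, diag_vec (H ** transpose R)) =
    (\<chi> i. y + l $ i *\<^sub>R R $ i) \<bullet> H"
  unfolding transpose_ones diag_vec_times_transpose inner_vec_def[of l] inner_vec_def[of _ H]
    inner_Pair
  by (simp add: inner_add_left inner_sum_right sum.distrib inner_vec_def[of l]
      inner_commute[of "H $ _"])

text \<open>
  A linear map between Euclidean spaces is onto iff nothing but zero is orthogonal to its range,
  that is, iff its adjoint has trivial kernel. The kernel elements \<open>(y, l)\<close> are the Lagrange
  multipliers of the linear and the diagonal constraint.
\<close>
lemma LICQ_iff_multipliers_trivial:
  fixes R :: "real ^ 'r ^ 'n"
  shows "LICQ R \<longleftrightarrow> (\<forall>y l. (\<forall>i. y + l $ i *\<^sub>R R $ i = 0) \<longrightarrow> y = 0 \<and> l = 0)"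
    (is "_ \<longleftrightarrow> ?trivial")
proof
  let ?L = "\<lambda>H :: real ^ 'r ^ 'n. (transpose H *v ones, diag_vec (H ** transpose R))"
  {
    assume surj: "LICQ R"
    show ?trivial
    proof (intro allI impI)
      fix y l assume kernel: "\<forall>i. y + l $ i *\<^sub>R R $ i = 0"
      have "range ?L = UNIV"
        using surj unfolding LICQ_def .
      then have "(y, l) \<in> range ?L"
        by (simp only: UNIV_I)
      then obtain H where H: "(y, l) = ?L H"
        by (rule imageE)
      have "(y, l) \<bullet> (y, l) = (\<chi> i. y + l $ i *\<^sub>R R $ i) \<bullet> H"
        using LICQ_map_adjoint[of y l H R] unfolding H[symmetric] .
      also have "\<dots> = 0"
        using kernel by (simp add: inner_vec_def)
      finally have "(y, l) = 0"
        by (simp only: inner_eq_zero_iff)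
      then show "y = 0 \<and> l = 0"
        by (simp add: zero_prod_def)
    qed
  next
    assume trivial: ?trivial
    show "LICQ R"
    proof (rule ccontr)
      assume "\<not> LICQ R"
      then have "range ?L \<noteq> UNIV"
        by (simp add: LICQ_def)
      moreover have "linear ?L"
        unfolding transpose_ones diag_vec_times_transpose
        by (rule linearI)
          (simp_all add: sum.distrib vec_eq_iff inner_add_left scaleR_sum_right)
      then have "span (range ?L) = range ?L"
        by (simp add: span_eq_iff linear_subspace_image)
      ultimately have "span (range ?L) \<noteq> UNIV"
        by (simp only: not_False_eq_True)
      from span_not_UNIV_orthogonal[OF this] obtain z
        where "z \<noteq> 0" and z: "\<forall>x \<in> span (range ?L). z \<bullet> x = 0"
        by blast
      obtain y l where yl: "z = (y, l)" by (cases z)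
      \<comment> \<open>With \<open>H\<close> the adjoint applied to \<open>z\<close>, orthogonality says that \<open>H\<close> is orthogonal to itself.\<close>
      have "(\<chi> i. y + l $ i *\<^sub>R R $ i) = 0"
        using bspec[OF z span_base[OF rangeI[of ?L "\<chi> i. y + l $ i *\<^sub>R R $ i"]]]
        unfolding yl LICQ_map_adjoint by (simp only: inner_eq_zero_iff)
      then have "\<forall>i. y + l $ i *\<^sub>R R $ i = 0"
        by (simp add: vec_eq_iff)
      then show False
        using trivial \<open>z \<noteq> 0\<close> yl by (auto simp: zero_prod_def)
    qed
  }
qed

section \<open>Matrices whose rows lie on a line\<close>

lemma row_outer: "outer v b $ i = v $ i *\<^sub>R b"
  by (simp add: vec_eq_iff outer_def)

lemma balanced_signs_iff:
  "v \<in> balanced_signs \<longleftrightarrow> (\<forall>i. \<bar>v $ i\<bar> = 1) \<and> (\<Sum>i\<in>UNIV. v $ i) = 0"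
proof -
  have "x \<in> {-1, 1} \<longleftrightarrow> \<bar>x\<bar> = 1" for x :: real
    by auto
  then show ?thesis
    by (simp only: balanced_signs_def mem_Collect_eq) (simp add: ones_def inner_vec_def)
qed

text \<open>
  Scaling the spanning vector to length one leaves each unit row a coefficient of absolute value
  one; summing the rows then shows that the coefficients cancel.
\<close>
lemma Bset0_iff_rows_on_line:
  fixes R :: "real ^ 'r ^ 'n"
  shows "R \<in> Bset0 \<longleftrightarrow> R \<in> Bset \<and> (\<exists>u. \<forall>i. R $ i \<in> span {u})"
proof
  assume "R \<in> Bset0"
  then obtain v b where R: "R = outer v b" and v: "v \<in> balanced_signs" and b: "norm b = 1"
    by (auto simp: Bset0_def)
  have "R \<in> Bset"
    using v b by (simp add: R Bset_iff row_outer balanced_signs_iff flip: scaleR_sum_left)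
  moreover have "\<forall>i. R $ i \<in> span {b}"
    by (simp add: R row_outer span_mul span_base)
  ultimately show "R \<in> Bset \<and> (\<exists>u. \<forall>i. R $ i \<in> span {u})" by blast
next
  assume asm: "R \<in> Bset \<and> (\<exists>u. \<forall>i. R $ i \<in> span {u})"
  then have unit: "\<And>i. norm (R $ i) = 1" and total: "(\<Sum>i\<in>UNIV. R $ i) = 0"
    by (auto simp: Bset_iff)
  obtain u where "\<forall>i. \<exists>c. R $ i = c *\<^sub>R u"
    using asm unfolding span_singleton by blast
  then obtain c where c: "\<And>i. R $ i = c i *\<^sub>R u" by metis
  have abs_c: "\<bar>c i\<bar> * norm u = 1" for i
    using unit[of i] by (simp add: c)
  have u: "norm u \<noteq> 0"
    using abs_c by fastforce
  define v :: "real ^ 'n" where "v = (\<chi> i. c i * norm u)"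
  define b where "b = u /\<^sub>R norm u"
  have R: "R = outer v b"
    using u by (simp add: vec_eq_iff[of R] row_outer c v_def b_def)
  have b: "norm b = 1"
    using u by (simp add: b_def)
  have "(\<Sum>i\<in>UNIV. v $ i) *\<^sub>R b = 0"
    using total by (simp add: R row_outer scaleR_sum_left)
  then have "v \<in> balanced_signs"
    using b abs_c by (auto simp: balanced_signs_iff v_def abs_mult)
  then show "R \<in> Bset0"
    using R b by (auto simp: Bset0_def)
qed

lemma rank_less_2_iff_rows_on_line:
  fixes R :: "real ^ 'r ^ 'n"
  shows "rank R < 2 \<longleftrightarrow> (\<exists>u. \<forall>i. R $ i \<in> span {u})"
proof -
  have rows: "rows R = range (($) R)"
    by (auto simp: rows_def row_def vec_nth_inverse)
  have rank: "rank R = dim (rows R)"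
    by (rule row_rank_def)
  show ?thesis
  proof
    assume less: "rank R < 2"
    obtain B where B: "B \<subseteq> rows R" "independent B" "rows R \<subseteq> span B" "card B = dim (rows R)"
      using basis_exists by blast
    have "finite B" "card B \<le> Suc 0"
      using B less rank by (auto intro: independent_imp_finite)
    then have "\<exists>u. B \<subseteq> {u}"
      unfolding card_le_Suc0_iff_eq[OF \<open>finite B\<close>] by blast
    then obtain u where "span B \<subseteq> span {u}"
      using span_mono by blast
    with B show "\<exists>u. \<forall>i. R $ i \<in> span {u}"
      unfolding rows by blast
  next
    assume "\<exists>u. \<forall>i. R $ i \<in> span {u}"
    then obtain u where "rows R \<subseteq> span {u}"
      unfolding rows by blast
    then have "dim (rows R) \<le> card {u}"
      by (intro dim_le_card) auto
    then show "rank R < 2"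
      by (simp add: rank)
  qed
qed

section \<open>The decomposition\<close>

text \<open>
  In a nontrivial relation \<open>y + l\<^sub>i r\<^sub>i = 0\<close>, unit rows force \<open>y \<noteq> 0\<close>, hence all \<open>l\<^sub>i \<noteq> 0\<close>, and one
  can solve for the rows.
\<close>
lemma not_LICQ_iff_Bset0:
  fixes R :: "real ^ 'r ^ 'n"
  assumes "R \<in> Bset"
  shows "\<not> LICQ R \<longleftrightarrow> R \<in> Bset0"
proof
  assume "\<not> LICQ R"
  then obtain y l where kernel: "\<And>i. y + l $ i *\<^sub>R R $ i = 0" and nz: "y \<noteq> 0 \<or> l \<noteq> 0"
    unfolding LICQ_iff_multipliers_trivial by blast
  have row_nz: "R $ i \<noteq> 0" for i
    using assms by (metis Bset_iff norm_zero zero_neq_one)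
  have y: "y \<noteq> 0"
  proof
    assume "y = 0"
    then have "l = 0"
      using kernel row_nz by (simp add: vec_eq_iff[of l])
    with \<open>y = 0\<close> nz show False by simp
  qed
  have "R $ i \<in> span {y}" for i
  proof -
    have li: "l $ i \<noteq> 0"
      using kernel[of i] y by auto
    have "l $ i *\<^sub>R R $ i = - y"
      using kernel[of i] by (metis add.commute eq_neg_iff_add_eq_0)
    then have "R $ i = (- 1 / l $ i) *\<^sub>R y"
      using li by (simp add: vec_eq_iff field_simps)
    then show ?thesis
      by (simp only: span_mul span_base singletonI)
  qed
  then show "R \<in> Bset0"
    using assms by (auto simp: Bset0_iff_rows_on_line)
next
  assume "R \<in> Bset0"
  then obtain v b where R: "R = outer v b" and v: "v \<in> balanced_signs" and b: "norm b = 1"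
    by (auto simp: Bset0_def)
  have "v $ i * v $ i = 1" for i
    using v by (auto simp: balanced_signs_def dest: spec[of _ i])
  then have "\<forall>i. b + (- v) $ i *\<^sub>R R $ i = 0"
    by (simp add: R row_outer)
  moreover have "b \<noteq> 0"
    using b by auto
  ultimately show "\<not> LICQ R"
    unfolding LICQ_iff_multipliers_trivial by blast
qed

text \<open>If \<open>p\<close> of \<open>n\<close> signs are positive, the signs add up to \<open>2p - n\<close>.\<close>
lemma balanced_signs_imp_even:
  assumes "v \<in> (balanced_signs :: (real ^ 'n) set)"
  shows "even CARD('n)"
proof -
  let ?P = "{i. v $ i = 1}"
  have "v $ i = 2 * of_bool (i \<in> ?P) - 1" for i
    using assms by (auto simp: balanced_signs_def dest: spec[of _ i])
  then have "(\<Sum>i\<in>UNIV. v $ i) = (\<Sum>i\<in>UNIV. 2 * of_bool (i \<in> ?P) - 1)"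
    by (rule sum.cong[OF refl])
  also have "\<dots> = 2 * real (card ?P) - real CARD('n)"
    by (simp add: sum_subtractf flip: sum_distrib_left)
  finally have "real (2 * card ?P) = real CARD('n)"
    using assms by (simp add: balanced_signs_iff)
  then have "2 * card ?P = CARD('n)"
    using of_nat_eq_iff by blast
  then show ?thesis
    by (metis dvd_triv_left)
qed

theorem proposition3p1:
  shows "(Bset :: (real ^ 'r ^ 'n) set) = Bset0 \<union> Bset1 \<and>
    (Bset0 :: (real ^ 'r ^ 'n) set) \<inter> Bset1 = {} \<and>
    (Bset0 :: (real ^ 'r ^ 'n) set) = singular_points \<and>
    (Bset1 :: (real ^ 'r ^ 'n) set) = smooth_points \<and>
    (odd CARD('n) \<longrightarrow> (Bset0 :: (real ^ 'r ^ 'n) set) = {})"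
proof -
  have sub: "(Bset0 :: (real ^ 'r ^ 'n) set) \<subseteq> Bset"
    by (auto simp: Bset0_iff_rows_on_line)
  have Bset1: "(Bset1 :: (real ^ 'r ^ 'n) set) = Bset - Bset0"
    by (auto simp: Bset1_def Bset0_iff_rows_on_line not_less simp flip: rank_less_2_iff_rows_on_line)
  have singular: "(Bset0 :: (real ^ 'r ^ 'n) set) = singular_points"
    unfolding singular_points_def using sub not_LICQ_iff_Bset0 by blast
  have smooth: "(Bset1 :: (real ^ 'r ^ 'n) set) = smooth_points"
    unfolding Bset1 smooth_points_def using not_LICQ_iff_Bset0 by blast
  have odd: "odd CARD('n) \<longrightarrow> (Bset0 :: (real ^ 'r ^ 'n) set) = {}"
    using balanced_signs_imp_even by (auto simp: Bset0_def)
  show ?thesis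
    using sub Bset1 singular smooth odd by blast
qed

end
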